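(* Let $P$ be a positive integer, let $V_n = V_n(P,1)$, and let $m,n\ge 1$ be integers. Then there is no integer $x$ such that $V_n = 5V_m x^2$.
   Context: For a positive integer $P$, the generalized Lucas sequence $V_n=V_n(P,1)$ is defined by $V_0=2$, $V_1=P$, and $V_{n+2}=PV_{n+1}+V_n$ for $n\ge 0$. *)

theory Defs
  imports Main
begin

text \<open>The sequence \<open>V\<^sub>n(P,Q)\<close> for the parameter \<open>Q = 1\<close>, in the sign convention
  \<open>V\<^sub>n\<^sub>+\<^sub>2 = P V\<^sub>n\<^sub>+\<^sub>1 + Q V\<^sub>n\<close> (so \<open>P = 1\<close> gives the usual Lucas numbers).\<close>

fun lucas_V :: "int \<Rightarrow> nat \<Rightarrow> int" where
  "lucas_V P 0 = 2"
| "lucas_V P (Suc 0) = P"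
| "lucas_V P (Suc (Suc n)) = P * lucas_V P (Suc n) + lucas_V P n"

end

theory Submission
  imports Defs "HOL-Computational_Algebra.Nth_Powers"
begin

text \<open>
  The idea is to turn a solution of \<open>V\<^sub>n = 5 V\<^sub>m x\<^sup>2\<close> into a rational point on a curve of genus one
  that has none.

  Divisibility comes first. If \<open>5\<close> divides \<open>V\<^sub>n(P)\<close>, then the norm identity for consecutive terms
  forces \<open>5\<close> to divide \<open>P\<close> (\<open>five_dvd_lucas_V\<close>); as \<open>V\<^sub>n(P) \<equiv> 2\<close> modulo \<open>P\<^sup>2\<close> for even \<open>n\<close>, the
  index \<open>n\<close> is odd. Since \<open>V\<^sub>m\<close> divides \<open>V\<^sub>n\<close>, the index \<open>n\<close> is an odd multiple \<open>m r\<close> of \<open>m\<close>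
  (\<open>lucas_V_dvd_imp_odd_multiple\<close>). For odd \<open>m\<close> the sequence can be iterated: with \<open>R = V\<^sub>m(P)\<close>,
  one has \<open>V\<^sub>n(P) = V\<^sub>r(R)\<close> (\<open>lucas_V_odd_mult_index\<close>), so the equation becomes
  \<open>V\<^sub>r(R) = 5 R x\<^sup>2\<close> with \<open>5\<close> dividing \<open>R\<close>. Because \<open>V\<^sub>r(R) / R \<equiv> r\<close> modulo \<open>R\<^sup>2\<close>, also \<open>5\<close> divides
  \<open>r\<close>. Writing \<open>r = 5 s\<close> and \<open>S = V\<^sub>s(R)\<close>, iteration gives
  \<open>V\<^sub>r(R) = V\<^sub>5(S) = S (S\<^sup>4 + 5 S\<^sup>2 + 5)\<close>. With \<open>S = R k = 5 a\<close> the equation reads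
  \<open>k (125 a\<^sup>4 + 25 a\<^sup>2 + 1) = x\<^sup>2\<close>, the two factors are coprime, and therefore
  \<open>125 a\<^sup>4 + 25 a\<^sup>2 + 1\<close> is a square with \<open>a > 0\<close>.

  That is impossible (\<open>quartic_no_solution\<close>). The quartic is a covering of the elliptic curve
  \<open>Y\<^sup>2 = X (X\<^sup>2 + 25 X + 125)\<close>, which has rank zero, and Fermat's infinite descent through the
  \<open>2\<close>-isogenous curve \<open>Y\<^sup>2 = X (X\<^sup>2 - 50 X + 125)\<close> can be carried out by hand with factorisations
  of differences of squares.
\<close>

section \<open>Arithmetic of squares and coprime factors\<close>

lemma odd_square_eq_8k_plus_1:
  fixes u :: int
  assumes "odd u"
  obtains k where "u\<^sup>2 = 8 * k + 1"
proof -
  obtain i where i: "u = 2 * i + 1"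
    using assms by (elim oddE)
  have "even (i * (i + 1))" by simp
  then obtain k where "i * (i + 1) = 2 * k" by (elim evenE)
  then have "u\<^sup>2 = 8 * k + 1"
    unfolding i by (simp add: power2_eq_square algebra_simps)
  then show ?thesis by (rule that)
qed

lemma square_mod_4_neq_3:
  fixes e q :: int
  shows "e\<^sup>2 \<noteq> 4 * q + 3"
proof
  assume *: "e\<^sup>2 = 4 * q + 3"
  show False
  proof (cases "even e")
    case True
    then obtain i where "e = 2 * i" by (elim evenE)
    then have "2 * (2 * i\<^sup>2) = 2 * (2 * q + 1) + 1"
      using * by (simp add: power2_eq_square)
    then show False by presburger
  next
    case False
    then obtain k where "e\<^sup>2 = 8 * k + 1" by (rule odd_square_eq_8k_plus_1)
    then show False using * by presburger
  qed
qed

lemma coprime_int_if_no_common_prime: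
  fixes a b :: int
  assumes "a \<noteq> 0"
    and "\<And>p. prime p \<Longrightarrow> p dvd a \<Longrightarrow> p dvd b \<Longrightarrow> False"
  shows "coprime a b"
proof (rule ccontr)
  assume "\<not> coprime a b"
  then have "\<not> is_unit (gcd a b)" by (simp add: coprime_iff_gcd_eq_1)
  moreover have "gcd a b \<noteq> 0" using assms(1) by simp
  ultimately obtain p where "prime p" "p dvd gcd a b"
    using prime_divisor_exists by blast
  then show False using assms(2)[of p] by simp
qed

lemma coprime_factors_of_nth_power_int:
  fixes a b c :: int
  assumes "coprime a b" "a * b = c ^ n" "a > 0" "b > 0" "c > 0" "n > 0"
  obtains s t where "a = s ^ n" "b = t ^ n" "s * t = c" "s > 0" "t > 0"
proof -
  have cop: "coprime (nat a) (nat b)"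
    using assms by (simp add: coprime_int_iff [symmetric])
  have prd: "nat a * nat b = nat c ^ n"
    using assms by (simp add: nat_mult_distrib [symmetric] nat_power_eq)
  have "is_nth_power n (nat a)" "is_nth_power n (nat b)"
    using is_nth_power_mult_coprime_natD[OF cop, of n] prd assms by simp_all
  then obtain s t where st: "nat a = s ^ n" "nat b = t ^ n"
    by (elim is_nth_powerE)
  then have "(s * t) ^ n = nat c ^ n" using prd by (simp add: power_mult_distrib)
  then have "s * t = nat c"
    using power_eq_imp_eq_base[of "s * t" n "nat c"] assms by simp
  then have stc: "int s * int t = c" using assms
    by (metis int_nat_eq less_imp_le of_nat_mult)
  have "a = int s ^ n" "b = int t ^ n"
    using st assms by (metis int_nat_eq less_imp_le of_nat_power)+
  moreover have "int s > 0" "int t > 0" using stc assms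
    by (metis of_nat_0_less_iff gr0I mult_zero_left mult_zero_right of_nat_0 less_irrefl)+
  ultimately show ?thesis using that stc by blast
qed

text \<open>
  The arithmetic step of each half of the descent: \<open>5\<close> can divide only one of the coprime factors,
  so that factor absorbs all of \<open>125\<close> and what remains is a product of coprime numbers that is a
  fourth power. The sum is symmetric in the two factors, so it does not matter which one \<open>5\<close> divides.
\<close>

lemma coprime_factors_of_125_fourth_power:
  fixes A B M :: int
  assumes cop: "coprime A B" and prd: "A * B = 125 * M ^ 4"
    and pos: "A > 0" "B > 0" "M > 0"
  obtains s t where "A + B = s ^ 4 + 125 * t ^ 4" "s * t = M" "s > 0" "t > 0"
    "coprime s t" "\<not> 5 dvd s"
proof -
  have p5: "prime (5::int)" by simp
  have main: "\<exists>s t. A + B = s ^ 4 + 125 * t ^ 4 \<and> s * t = M \<and> s > 0 \<and> t > 0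
      \<and> coprime s t \<and> \<not> 5 dvd s"
    if cop: "coprime A B" and prd: "A * B = 125 * M ^ 4" and pos: "A > 0" "B > 0"
      and five: "5 dvd A" for A B :: int
  proof -
    have nd: "\<not> 5 dvd B"
      using cop five p5 by (metis coprime_common_divisor not_prime_unit)
    then have "coprime (5 ^ 3) B"
      using p5 by (intro coprime_power_left_iff[THEN iffD2] disjI1 prime_imp_coprime)
    moreover have "5 ^ 3 dvd A * B" by (simp add: prd)
    ultimately have "5 ^ 3 dvd A" by (simp add: coprime_dvd_mult_left_iff)
    then obtain A' where A': "A = 125 * A'" by (auto elim: dvdE)
    have "A' > 0" using A' pos by simp
    moreover have "coprime A' B" using cop A' by (simp add: coprime_mult_left_iff)
    moreover have "A' * B = M ^ 4" using prd A' by simp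
    ultimately obtain t s where ts: "A' = t ^ 4" "B = s ^ 4" "t * s = M" "t > 0" "s > 0"
      using coprime_factors_of_nth_power_int[of A' B M 4] pos \<open>M > 0\<close> by auto
    have "coprime s t" using \<open>coprime A' B\<close> ts by (simp add: coprime_commute)
    moreover have "\<not> 5 dvd s" using nd ts by (metis dvd_power dvd_trans zero_less_numeral)
    ultimately show ?thesis using ts A' by (intro exI[of _ s] exI[of _ t]) (auto simp: mult.commute)
  qed
  have "5 dvd A * B" by (simp add: prd)
  then consider "5 dvd A" | "5 dvd B" using p5 by (auto simp: prime_dvd_mult_iff)
  then have "\<exists>s t. A + B = s ^ 4 + 125 * t ^ 4 \<and> s * t = M \<and> s > 0 \<and> t > 0
      \<and> coprime s t \<and> \<not> 5 dvd s"
  proof cases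
    case 1
    then show ?thesis using main[of A B] assms by simp
  next
    case 2
    then show ?thesis
      using main[of B A] assms by (simp add: coprime_commute mult.commute add.commute)
  qed
  then show ?thesis using that by blast
qed

section \<open>A quartic without points\<close>

text \<open>
  In the descent the factors are \<open>c - N\<close> and \<open>c + N\<close> up to a common constant, and the root \<open>N\<close>
  cancels from their sum; coprimality is therefore tested against the sum.
\<close>

lemma coprime_factors_from_sum:
  fixes A B M f :: int
  assumes prd: "A * B = 125 * M ^ 4" and "M > 0"
    and no: "\<And>p. prime p \<Longrightarrow> p dvd M \<or> p = 5 \<Longrightarrow> p dvd A \<Longrightarrow> p dvd A + B \<Longrightarrow> False"
  shows "coprime A B"
proof (rule coprime_int_if_no_common_prime)
  show "A \<noteq> 0" using assms by auto
next
  fix p :: int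
  assume p: "prime p" "p dvd A" "p dvd B"
  then have "p dvd A * B" by simp
  then have "p dvd 5 ^ 3 * M ^ 4" by (simp add: prd)
  then have "p dvd 5 ^ 3 \<or> p dvd M ^ 4" using p(1) by (simp only: prime_dvd_mult_iff)
  then have "p dvd 5 \<or> p dvd M" using p(1) prime_dvd_power by blast
  then have "p dvd M \<or> p = 5" using p(1) primes_dvd_imp_eq[of p 5] by auto
  moreover have "p dvd A + B" using p by simp
  ultimately show False using no p by blast
qed


text \<open>
  Infinite descent on \<open>M\<close>. Completing the square writes \<open>125 M\<^sup>4\<close> as a difference of two squares, and
  splitting it into coprime factors gives \<open>u, v\<close> with
  \<open>e\<^sup>2 = u\<^sup>4 - 50 u\<^sup>2 v\<^sup>2 + 125 v\<^sup>4\<close>, a point on the \<open>2\<close>-isogenous quartic. The same step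
  applied to this equation gives \<open>s, t\<close> with \<open>u\<^sup>2 = s\<^sup>4 + 25 s\<^sup>2 t\<^sup>2 + 125 t\<^sup>4\<close> and
  \<open>M = 2 u s t\<close>, a smaller point on the original quartic. All other parities and signs are excluded
  by congruences modulo powers of \<open>2\<close>. The homogeneous form with a variable \<open>e\<close> is what makes the
  statement stable under descent, and \<open>5\<close> not dividing \<open>e\<close> is what keeps the factors coprime.
\<close>

theorem quartic_no_solution:
  fixes e M N :: int
  assumes "M > 0" "coprime e M" "\<not> 5 dvd e"
  shows "N\<^sup>2 \<noteq> e ^ 4 + 25 * e\<^sup>2 * M\<^sup>2 + 125 * M ^ 4"
  using assms
proof (induction "nat M" arbitrary: e M N rule: less_induct)
  case less
  note M0 = less.prems(1) and cop = less.prems(2) and nd = less.prems(3)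
  have common: False if "prime p" "p dvd M" "p dvd e" for p
    using that cop by (meson coprime_common_divisor not_prime_unit)
  show ?case
  proof
    assume eq: "N\<^sup>2 = e ^ 4 + 25 * e\<^sup>2 * M\<^sup>2 + 125 * M ^ 4"
    show False
    proof (cases "even M")
      case False
      \<comment> \<open>Here the factors are odd, hence coprime without halving, and the isogenous quartic
        represents \<open>4 e\<^sup>2\<close>; but for odd \<open>u, v\<close> its value is \<open>12\<close> modulo \<open>16\<close>.\<close>
      define A B where "A = 2 * e\<^sup>2 + 25 * M\<^sup>2 - 2 * N" and "B = 2 * e\<^sup>2 + 25 * M\<^sup>2 + 2 * N"
      have AB: "A * B = 125 * M ^ 4"
      proof -
        have "A * B = (2 * e\<^sup>2 + 25 * M\<^sup>2)\<^sup>2 - 4 * N\<^sup>2"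
          unfolding A_def B_def by (simp add: power2_eq_square algebra_simps)
        also have "\<dots> = 125 * M ^ 4"
          unfolding eq by (simp add: power2_eq_square power4_eq_xxxx algebra_simps)
        finally show ?thesis .
      qed
      have sum: "A + B = 4 * e\<^sup>2 + 50 * M\<^sup>2" unfolding A_def B_def by simp
      have "M\<^sup>2 > 0" "M ^ 4 > 0" "e\<^sup>2 \<ge> 0" using M0 by simp_all
      then have "A + B > 0" "A * B > 0" using sum AB by linarith+
      then have pos: "A > 0" "B > 0" by (auto simp: zero_less_mult_iff)
      have oddA: "odd A" unfolding A_def using False by simp
      have "coprime A B"
      proof (rule coprime_factors_from_sum[OF AB M0])
        fix p :: int
        assume p: "prime p" "p dvd M \<or> p = 5" "p dvd A" "p dvd A + B"
        have "\<not> p dvd 2"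
        proof
          assume "p dvd 2"
          then have "p = 2" using p(1) primes_dvd_imp_eq[of p 2] by auto
          then show False using oddA p(3) by simp
        qed
        have "p dvd 50 * M\<^sup>2" using p(2) by (auto simp: power2_eq_square)
        then have "p dvd 4 * e\<^sup>2" using p(4) sum by (simp add: dvd_add_left_iff)
        then have "p dvd 2 * (2 * (e * e))" by (simp add: power2_eq_square)
        then have "p dvd e" using p(1) \<open>\<not> p dvd 2\<close> by (simp only: prime_dvd_mult_iff) auto
        then show False using p(1,2) nd common by auto
      qed
      then obtain u v where uv: "A + B = u ^ 4 + 125 * v ^ 4" "u * v = M"
        using coprime_factors_of_125_fourth_power[OF _ AB pos M0] by metis
      then have "odd u" "odd v" using False by auto
      then obtain k l where kl: "u\<^sup>2 = 8 * k + 1" "v\<^sup>2 = 8 * l + 1"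
        by (metis odd_square_eq_8k_plus_1)
      have "4 * e\<^sup>2 = (u\<^sup>2)\<^sup>2 + 125 * (v\<^sup>2)\<^sup>2 - 50 * (u\<^sup>2 * v\<^sup>2)"
        using sum uv by (simp add: power_mult_distrib [symmetric] flip: power_mult)
      also have "\<dots> = 4 * (4 * (4 * k\<^sup>2 + k + 500 * l\<^sup>2 + 125 * l - 200 * (k * l) - 25 * k - 25 * l + 4) + 3)"
        unfolding kl by (simp add: power2_eq_square algebra_simps)
      finally have "e\<^sup>2 = 4 * (4 * k\<^sup>2 + k + 500 * l\<^sup>2 + 125 * l - 200 * (k * l) - 25 * k - 25 * l + 4) + 3"
        by simp
      then show False using square_mod_4_neq_3 by blast
    next
      case True
      then obtain b where b: "M = 2 * b" by (elim evenE)
      have b0: "b > 0" using b M0 by simp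
      have "odd e" using True common[of 2] by auto
      have "odd (N\<^sup>2)" unfolding eq using True \<open>odd e\<close> by simp
      then have "odd N" by simp
      then have "even (e\<^sup>2 + 50 * b\<^sup>2 - N)" using \<open>odd e\<close> by simp
      then obtain A where A: "e\<^sup>2 + 50 * b\<^sup>2 - N = 2 * A" by (elim evenE)
      define B where "B = A + N"
      have B: "2 * B = e\<^sup>2 + 50 * b\<^sup>2 + N" using A unfolding B_def by simp
      have AB: "A * B = 125 * b ^ 4"
      proof -
        have "4 * (A * B) = (2 * A) * (2 * B)" by simp
        also have "\<dots> = (e\<^sup>2 + 50 * b\<^sup>2)\<^sup>2 - N\<^sup>2"
          unfolding A [symmetric] B by (simp add: power2_eq_square algebra_simps)
        also have "\<dots> = 4 * (125 * b ^ 4)"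
          unfolding eq b by (simp add: power2_eq_square power4_eq_xxxx algebra_simps)
        finally show ?thesis by simp
      qed
      have sum: "A + B = e\<^sup>2 + 50 * b\<^sup>2" using A B by simp
      have "b\<^sup>2 > 0" "b ^ 4 > 0" "e\<^sup>2 \<ge> 0" using b0 by simp_all
      then have "A + B > 0" "A * B > 0" using sum AB by linarith+
      then have pos: "A > 0" "B > 0" by (auto simp: zero_less_mult_iff)
      have "coprime A B"
      proof (rule coprime_factors_from_sum[OF AB b0])
        fix p :: int
        assume p: "prime p" "p dvd b \<or> p = 5" "p dvd A" "p dvd A + B"
        have "p dvd 50 * b\<^sup>2" using p(2) by (auto simp: power2_eq_square)
        then have "p dvd e\<^sup>2" using p(4) sum by (simp add: dvd_add_left_iff)
        then have "p dvd e" using p(1) prime_dvd_power by blast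
        then show False using p(1,2) nd common[of p] b by auto
      qed
      then obtain u v where uv: "A + B = u ^ 4 + 125 * v ^ 4" "u * v = b" "u > 0" "v > 0"
          "coprime u v" "\<not> 5 dvd u"
        using coprime_factors_of_125_fourth_power[OF _ AB pos b0] by metis
      have e2: "e\<^sup>2 = (u\<^sup>2)\<^sup>2 + 125 * (v\<^sup>2)\<^sup>2 - 50 * (u\<^sup>2 * v\<^sup>2)"
        using sum uv by (simp add: power_mult_distrib [symmetric] flip: power_mult)
      have "odd (e\<^sup>2)" using \<open>odd e\<close> by simp
      then have par: "even u \<longleftrightarrow> odd v" unfolding e2 by auto
      obtain c where c: "e\<^sup>2 = 8 * c + 1" using \<open>odd e\<close> by (rule odd_square_eq_8k_plus_1)
      \<comment> \<open>If \<open>u\<close> were even and \<open>v\<close> odd, \<open>e\<^sup>2\<close> would be \<open>125 \<equiv> 5\<close> modulo \<open>8\<close>.\<close>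
      have "odd u"
      proof
        assume "even u"
        then obtain i where i: "u = 2 * i" by (elim evenE)
        obtain l where l: "v\<^sup>2 = 8 * l + 1" using par \<open>even u\<close> odd_square_eq_8k_plus_1 by blast
        have "8 * c + 1 = 8 * (2 * (i\<^sup>2)\<^sup>2 + 1000 * l\<^sup>2 + 250 * l - 25 * (i\<^sup>2 * v\<^sup>2) + 15) + 5"
          using e2 unfolding c l i by (simp add: power2_eq_square algebra_simps)
        then obtain q where "8 * c + 1 = 8 * q + 5" by blast
        then show False by presburger
      qed
      then have "even v" using par by simp
      \<comment> \<open>Second half of the descent, starting from
        \<open>(u\<^sup>2 - 25 v\<^sup>2)\<^sup>2 - e\<^sup>2 = 500 v\<^sup>4\<close>.\<close>
      then have "even (u\<^sup>2 - 25 * v\<^sup>2 - e)" using \<open>odd u\<close> \<open>odd e\<close> by simp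
      then obtain C where C: "u\<^sup>2 - 25 * v\<^sup>2 - e = 2 * C" by (elim evenE)
      define D where "D = C + e"
      have D: "2 * D = u\<^sup>2 - 25 * v\<^sup>2 + e" using C unfolding D_def by simp
      have CD: "C * D = 125 * v ^ 4"
      proof -
        have "4 * (C * D) = (2 * C) * (2 * D)" by simp
        also have "\<dots> = (u\<^sup>2 - 25 * v\<^sup>2)\<^sup>2 - e\<^sup>2"
          unfolding C [symmetric] D by (simp add: power2_eq_square algebra_simps)
        also have "\<dots> = 4 * (125 * v ^ 4)"
          unfolding e2 by (simp add: power2_eq_square power4_eq_xxxx algebra_simps)
        finally show ?thesis by simp
      qed
      have sumCD: "C + D = u\<^sup>2 - 25 * v\<^sup>2" using C D by simp
      have copCD: "coprime C D"
      proof (rule coprime_factors_from_sum[OF CD \<open>v > 0\<close>])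
        fix p :: int
        assume p: "prime p" "p dvd v \<or> p = 5" "p dvd C" "p dvd C + D"
        have "p dvd 25 * v\<^sup>2" using p(2) by (auto simp: power2_eq_square)
        then have "p dvd (C + D) + 25 * v\<^sup>2" using p(4) by simp
        then have "p dvd u\<^sup>2" using sumCD by simp
        then have "p dvd u" using p(1) prime_dvd_power by blast
        then show False using p(1,2) uv(5,6) by (meson coprime_common_divisor not_prime_unit)
      qed
      have "v ^ 4 > 0" using uv by simp
      then have "C * D > 0" using CD by linarith
      then consider "C > 0" "D > 0" | "- C > 0" "- D > 0"
        by (auto simp: zero_less_mult_iff)
      then show False
      proof cases
        case 1
        obtain s t where st: "C + D = s ^ 4 + 125 * t ^ 4" "s * t = v" "s > 0" "t > 0"
            "coprime s t" "\<not> 5 dvd s"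
          using coprime_factors_of_125_fourth_power[OF copCD CD 1 \<open>v > 0\<close>] by metis
        have "u\<^sup>2 = s ^ 4 + 25 * s\<^sup>2 * t\<^sup>2 + 125 * t ^ 4"
          using sumCD st(1) by (simp add: st(2) [symmetric] power_mult_distrib)
        moreover have "t < M"
        proof -
          have "t \<le> v" using mult_right_mono[of 1 s t] st by simp
          also have "v \<le> b" using mult_right_mono[of 1 u v] uv by simp
          also have "b < M" using b b0 by simp
          finally show ?thesis .
        qed
        ultimately show False using less.hyps[of t s u] st by simp
      next
        case 2
        \<comment> \<open>Negative factors would mean \<open>- u\<^sup>2 = s\<^sup>4 - 25 s\<^sup>2 t\<^sup>2 + 125 t\<^sup>4\<close>, which is solvable over the
          reals but not modulo \<open>4\<close>, since exactly one of \<open>s, t\<close> is even.\<close>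
        have "coprime (- C) (- D)" "(- C) * (- D) = 125 * v ^ 4" using copCD CD by simp_all
        then obtain s t where st: "- C + - D = s ^ 4 + 125 * t ^ 4" "s * t = v" "coprime s t"
          using coprime_factors_of_125_fourth_power[OF _ _ 2 \<open>v > 0\<close>] by metis
        have u2: "u\<^sup>2 = 25 * (s\<^sup>2 * t\<^sup>2) - (s\<^sup>2)\<^sup>2 - 125 * (t\<^sup>2)\<^sup>2"
          using sumCD st(1) by (simp add: st(2) [symmetric] power_mult_distrib flip: power_mult)
        have "even s \<or> even t" using \<open>even v\<close> st(2) by auto
        then consider i where "s = 2 * i" "odd t" | i where "t = 2 * i" "odd s"
          using st(3) by (metis coprime_common_divisor evenE odd_one)
        then show False
        proof cases
          case 1
          obtain l where l: "t\<^sup>2 = 8 * l + 1" using 1 odd_square_eq_8k_plus_1 by blast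
          have "u\<^sup>2 = 4 * (25 * (i\<^sup>2 * t\<^sup>2) - 4 * (i\<^sup>2)\<^sup>2 - 2000 * l\<^sup>2 - 500 * l - 32) + 3"
            using u2 unfolding l 1 by (simp add: power2_eq_square algebra_simps)
          then show False using square_mod_4_neq_3 by blast
        next
          case 2
          obtain l where l: "s\<^sup>2 = 8 * l + 1" using 2 odd_square_eq_8k_plus_1 by blast
          have "u\<^sup>2 = 4 * (25 * (i\<^sup>2 * s\<^sup>2) - 500 * (i\<^sup>2)\<^sup>2 - 16 * l\<^sup>2 - 4 * l - 1) + 3"
            using u2 unfolding l 2 by (simp add: power2_eq_square algebra_simps)
          then show False using square_mod_4_neq_3 by blast
        qed
      qed
    qed
  qed
qed

section \<open>Lucas sequences\<close>

lemma lucas_V_pos: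
  assumes "P > 0"
  shows "lucas_V P n > 0"
  using assms by (induction P n rule: lucas_V.induct) (auto intro: add_pos_pos)

lemma lucas_V_less_Suc:
  assumes "P > 2"
  shows "lucas_V P n < lucas_V P (Suc n)"
proof (cases n)
  case 0
  then show ?thesis using assms by simp
next
  case (Suc k)
  have "lucas_V P (Suc k) * 1 \<le> lucas_V P (Suc k) * P"
    using assms lucas_V_pos[of P "Suc k"] by (intro mult_left_mono) auto
  then show ?thesis
    using Suc lucas_V_pos[of P k] assms by (simp add: mult.commute)
qed

lemma lucas_V_strict_mono:
  assumes "P > 2" "k < n"
  shows "lucas_V P k < lucas_V P n"
  using lift_Suc_mono_less[of "lucas_V P" k n] lucas_V_less_Suc assms by blast

text \<open>
  With the roots \<open>\<alpha>, \<beta>\<close> of \<open>X\<^sup>2 - P X - 1\<close>, where \<open>V\<^sub>n = \<alpha>\<^sup>n + \<beta>\<^sup>n\<close> and \<open>\<alpha> \<beta> = - 1\<close>, this is the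
  expansion of \<open>(\<alpha>\<^bsup>b+d\<^esup> + \<beta>\<^bsup>b+d\<^esup>) (\<alpha>\<^sup>b + \<beta>\<^sup>b)\<close>.
\<close>

lemma lucas_V_mult:
  "lucas_V P (b + d) * lucas_V P b = lucas_V P (2 * b + d) + (- 1) ^ b * lucas_V P d"
proof (induction b arbitrary: d rule: induct_nat_012)
  case 0
  then show ?case by simp
next
  case 1
  then show ?case by (simp add: algebra_simps)
next
  case (ge2 b)
  have "lucas_V P (Suc (Suc b) + d) * lucas_V P (Suc (Suc b))
      = P * (lucas_V P (Suc b + Suc d) * lucas_V P (Suc b)) + lucas_V P (b + Suc (Suc d)) * lucas_V P b"
    by (simp add: algebra_simps)
  also have "\<dots> = P * lucas_V P (Suc (2 * b + Suc (Suc d))) + lucas_V P (2 * b + Suc (Suc d))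
      + (- 1) ^ b * (lucas_V P (Suc (Suc d)) - P * lucas_V P (Suc d))"
    unfolding ge2 by (simp add: algebra_simps)
  also have "\<dots> = lucas_V P (2 * Suc (Suc b) + d) + (- 1) ^ Suc (Suc b) * lucas_V P d"
    by simp
  finally show ?case .
qed

text \<open>
  For odd \<open>m\<close> the powers \<open>\<alpha>\<^sup>m, \<beta>\<^sup>m\<close> have sum \<open>V\<^sub>m\<close> and product \<open>- 1\<close>, so they are the roots that
  define the sequence with parameter \<open>V\<^sub>m\<close>.
\<close>

lemma lucas_V_odd_mult_index:
  assumes "odd m"
  shows "lucas_V P (m * r) = lucas_V (lucas_V P m) r"
proof (induction r rule: induct_nat_012)
  case (ge2 r)
  have "lucas_V P (m + m * r) * lucas_V P m = lucas_V P (2 * m + m * r) - lucas_V P (m * r)"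
    using lucas_V_mult[of P m "m * r"] assms by simp
  moreover have "2 * m + m * r = m * Suc (Suc r)" "m + m * r = m * Suc r" by simp_all
  ultimately show ?case using ge2 by (simp del: mult_Suc_right add: algebra_simps)
qed simp_all

text \<open>
  Modulo \<open>V\<^sub>m\<close>, the product formula makes \<open>V\<^sub>n\<close> equal to \<open>V\<^sub>d\<close> up to sign for \<open>d = \<bar>n - 2 m\<bar>\<close>, so the
  index can be reduced until it is at most \<open>m\<close>; an index below \<open>m\<close> gives a positive value too small
  to be divisible by \<open>V\<^sub>m\<close>. Each reduction step changes the quotient \<open>n / m\<close> by \<open>2\<close>, which keeps it
  odd. The bound on \<open>P\<close> puts \<open>V\<^sub>0 = 2\<close> below \<open>V\<^sub>1 = P\<close>.
\<close>

lemma lucas_V_dvd_imp_odd_multiple: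
  assumes "P > 2" "m \<ge> 1" "lucas_V P m dvd lucas_V P n"
  shows "\<exists>r. odd r \<and> n = m * r"
  using assms(3)
proof (induction n rule: less_induct)
  case (less n)
  have nm: "\<not> lucas_V P m dvd lucas_V P k" if "k < m" for k
    using lucas_V_strict_mono[OF assms(1) that] lucas_V_pos[of P k] assms(1)
    by (auto dest!: zdvd_imp_le)
  consider "n < m" | "n = m" | "m < n" "n < 2 * m" | "2 * m \<le> n" by linarith
  then show ?case
  proof cases
    case 1
    then show ?thesis using nm less.prems by simp
  next
    case 2
    then show ?thesis by (intro exI[of _ 1]) simp
  next
    case 3
    define k where "k = n - m"
    define d where "d = 2 * m - n"
    have m: "m = k + d" and n: "n = 2 * k + d" and "d < m" using 3 by (auto simp: k_def d_def)
    have "lucas_V P m dvd lucas_V P n + (- 1) ^ k * lucas_V P d"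
      using lucas_V_mult[of P k d] by (metis dvd_triv_left m n)
    then have "lucas_V P m dvd (- 1) ^ k * lucas_V P d"
      using less.prems by (simp add: dvd_add_right_iff)
    then have "lucas_V P m dvd lucas_V P d" by (cases "even k") simp_all
    then show ?thesis using nm[OF \<open>d < m\<close>] by simp
  next
    case 4
    define d where "d = n - 2 * m"
    have n: "n = 2 * m + d" using 4 by (simp add: d_def)
    have "lucas_V P m dvd lucas_V P n + (- 1) ^ m * lucas_V P d"
      using lucas_V_mult[of P m d] by (metis dvd_triv_right n)
    then have "lucas_V P m dvd (- 1) ^ m * lucas_V P d"
      using less.prems by (simp add: dvd_add_right_iff)
    then have "lucas_V P m dvd lucas_V P d" by (cases "even m") simp_all
    then obtain r where "odd r" "d = m * r" using less.IH[of d] n assms(2) by auto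
    then show ?thesis using n by (intro exI[of _ "r + 2"]) (simp add: algebra_simps)
  qed
qed

text \<open>
  The lowest terms of \<open>V\<^sub>r(R)\<close> as a polynomial in \<open>R\<close>: the polynomial is even with constant term \<open>2\<close>
  for even \<open>r\<close>, and odd with linear term \<open>r R\<close> for odd \<open>r\<close>.
\<close>

lemma lucas_V_expansion:
  "\<exists>x y. lucas_V R (2 * j) = 2 + R\<^sup>2 * x
    \<and> lucas_V R (2 * j + 1) = R * (int (2 * j + 1) + R\<^sup>2 * y)"
proof (induction j)
  case 0
  then show ?case by (intro exI[of _ 0]) simp
next
  case (Suc j)
  then obtain x y where xy: "lucas_V R (2 * j) = 2 + R\<^sup>2 * x"
    "lucas_V R (2 * j + 1) = R * (int (2 * j + 1) + R\<^sup>2 * y)" by blast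
  define x' where "x' = x + int (2 * j + 1) + R\<^sup>2 * y"
  have 1: "lucas_V R (2 * Suc j) = 2 + R\<^sup>2 * x'"
    using xy by (simp add: x'_def power2_eq_square algebra_simps)
  have "lucas_V R (2 * Suc j + 1) = R * lucas_V R (2 * Suc j) + lucas_V R (2 * j + 1)" by simp
  also have "\<dots> = R * (int (2 * Suc j + 1) + R\<^sup>2 * (x' + y))"
    unfolding 1 xy by (simp add: power2_eq_square algebra_simps)
  finally show ?case using 1 by blast
qed

lemma lucas_V_odd_expansion:
  assumes "odd r"
  obtains y where "lucas_V R r = R * (int r + R\<^sup>2 * y)"
  using lucas_V_expansion[of R "r div 2"] assms by (metis odd_two_times_div_two_succ)

lemma lucas_V_5:
  "lucas_V S 5 = S * (S ^ 4 + 5 * S\<^sup>2 + 5)"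
  by (simp add: eval_nat_numeral algebra_simps)

lemma square_mod_5:
  fixes a :: int
  assumes "\<not> 5 dvd a"
  shows "a\<^sup>2 mod 5 = 1 \<or> a\<^sup>2 mod 5 = 4"
proof -
  have "a mod 5 \<in> {1, 2, 3, 4}" using assms by (auto simp: dvd_eq_mod_eq_0)
  moreover have "a\<^sup>2 mod 5 = (a mod 5)\<^sup>2 mod 5" by (simp add: power_mod)
  ultimately show ?thesis by auto
qed

text \<open>
  The left-hand side is the norm form of \<open>X\<^sup>2 - P X - 1\<close>; a shift of the index multiplies it by the
  norm \<open>- 1\<close> of a root.
\<close>

lemma lucas_V_norm:
  "(lucas_V P (Suc n))\<^sup>2 - P * lucas_V P (Suc n) * lucas_V P n - (lucas_V P n)\<^sup>2
    = (- 1) ^ Suc n * (P\<^sup>2 + 4)"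
proof (induction n)
  case (Suc n)
  have "(lucas_V P (Suc (Suc n)))\<^sup>2 - P * lucas_V P (Suc (Suc n)) * lucas_V P (Suc n) - (lucas_V P (Suc n))\<^sup>2
    = - ((lucas_V P (Suc n))\<^sup>2 - P * lucas_V P (Suc n) * lucas_V P n - (lucas_V P n)\<^sup>2)"
    by (simp add: power2_eq_square algebra_simps)
  then show ?case using Suc by simp
qed (simp add: power2_eq_square)

text \<open>
  Consecutive terms are never both divisible by \<open>5\<close>, because then so would be \<open>V\<^sub>0 = 2\<close>. Hence if
  \<open>V\<^sub>n\<close> is divisible by \<open>5\<close>, the norm identity makes \<open>\<plusminus> (P\<^sup>2 + 4)\<close> a nonzero square modulo \<open>5\<close>. For \<open>P\<close>
  prime to \<open>5\<close>, however, \<open>P\<^sup>2 + 4\<close> is \<open>0\<close> or \<open>3\<close>, and neither \<open>0\<close> nor \<open>\<plusminus> 3\<close> is such a square.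
\<close>

lemma five_dvd_lucas_V:
  assumes "5 dvd lucas_V P n"
  shows "5 dvd P"
proof (rule ccontr)
  assume P: "\<not> 5 dvd P"
  have "\<not> (5 dvd lucas_V P k \<and> 5 dvd lucas_V P (Suc k))" for k
  proof (induction k)
    case (Suc k)
    then show ?case by (auto simp: dvd_add_right_iff)
  qed simp
  then have nd: "\<not> 5 dvd lucas_V P (Suc n)" using assms by blast
  obtain w where w: "lucas_V P n = 5 * w" using assms by (elim dvdE)
  define z where "z = P * lucas_V P (Suc n) * w + 5 * w\<^sup>2"
  have "(lucas_V P (Suc n))\<^sup>2 = 5 * z + (- 1) ^ Suc n * (P\<^sup>2 + 4)"
    using lucas_V_norm[of P n] unfolding w z_def by (simp add: power2_eq_square algebra_simps)
  then have "(lucas_V P (Suc n))\<^sup>2 = 5 * z + (P\<^sup>2 + 4) \<or> (lucas_V P (Suc n))\<^sup>2 = 5 * z - (P\<^sup>2 + 4)"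
    by (cases "even n") auto
  then show False using square_mod_5[OF P] square_mod_5[OF nd] by presburger
qed

section \<open>The equation\<close>

theorem theorem3p4:
  fixes P :: int and m n :: nat
  assumes "P > 0" and "m \<ge> 1" and "n \<ge> 1"
  shows "\<not> (\<exists>x::int. lucas_V P n = 5 * lucas_V P m * x\<^sup>2)"
proof
  assume "\<exists>x::int. lucas_V P n = 5 * lucas_V P m * x\<^sup>2"
  then obtain x where x: "lucas_V P n = 5 * lucas_V P m * x\<^sup>2" by blast
  have "5 dvd P" using x by (intro five_dvd_lucas_V[of P n]) simp
  then have "P > 2" using \<open>P > 0\<close> by (auto dest: zdvd_imp_le)
  have "odd n"
  proof
    assume "even n"
    then obtain j where "n = 2 * j" by (elim evenE)
    then obtain y where "lucas_V P n = 2 + P\<^sup>2 * y" using lucas_V_expansion[of P j] by blast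
    then have "5 dvd 2 + P\<^sup>2 * y" using x by (metis dvd_triv_left mult.assoc)
    moreover have "5 dvd P\<^sup>2 * y" using \<open>5 dvd P\<close> by (simp add: power2_eq_square)
    ultimately have "(5::int) dvd 2" by (simp add: dvd_add_left_iff)
    then show False by simp
  qed
  define R where "R = lucas_V P m"
  obtain r where r: "odd r" "n = m * r"
    using lucas_V_dvd_imp_odd_multiple[OF \<open>P > 2\<close> assms(2), of n] x by auto
  then have "odd m" using \<open>odd n\<close> by simp
  then have Vr: "lucas_V R r = 5 * R * x\<^sup>2"
    using x r lucas_V_odd_mult_index[of m P r] by (simp add: R_def)
  have "R > 0" using lucas_V_pos[OF \<open>P > 0\<close>] by (simp add: R_def)
  have "5 dvd R"
    using lucas_V_odd_expansion[OF \<open>odd m\<close>, of P] \<open>5 dvd P\<close> unfolding R_def by (metis dvd_mult2)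
  obtain y where y: "lucas_V R r = R * (int r + R\<^sup>2 * y)"
    using lucas_V_odd_expansion[OF \<open>odd r\<close>] by blast
  then have "5 * x\<^sup>2 = int r + R\<^sup>2 * y" using Vr \<open>R > 0\<close> by simp
  then have "5 dvd int r + R\<^sup>2 * y" by (metis dvd_triv_left)
  moreover have "5 dvd R\<^sup>2 * y" using \<open>5 dvd R\<close> by (simp add: power2_eq_square)
  ultimately have "5 dvd int r" by (simp add: dvd_add_left_iff)
  then have "5 dvd r" by presburger
  then obtain s where s: "r = s * 5" by (metis dvdE mult.commute)
  then have "odd s" using \<open>odd r\<close> by simp
  define S where "S = lucas_V R s"
  have VS: "S * (S ^ 4 + 5 * S\<^sup>2 + 5) = 5 * R * x\<^sup>2"
    using Vr lucas_V_odd_mult_index[OF \<open>odd s\<close>, of R 5] lucas_V_5[of S] by (simp add: s S_def)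
  obtain k where k: "S = R * k"
    using lucas_V_odd_expansion[OF \<open>odd s\<close>, of R] unfolding S_def by metis
  have "S > 0" using lucas_V_pos[OF \<open>R > 0\<close>] by (simp add: S_def)
  then have "k > 0" using k \<open>R > 0\<close> by (simp add: zero_less_mult_iff)
  obtain a where a: "S = 5 * a" using \<open>5 dvd R\<close> k by (metis dvd_mult2 dvdE)
  have "a > 0" using a \<open>S > 0\<close> by simp
  define W where "W = 1 + 25 * a\<^sup>2 + 125 * a ^ 4"
  have "W > 0" using \<open>a > 0\<close> by (simp add: W_def add_pos_pos)
  have "S ^ 4 + 5 * S\<^sup>2 + 5 = 5 * W" unfolding a W_def by (simp add: power_mult_distrib)
  then have "(5 * R) * (k * W) = (5 * R) * x\<^sup>2" using VS k by simp
  then have kW: "k * W = x\<^sup>2" using \<open>R > 0\<close> by simp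
  have "coprime k W"
  proof (rule coprime_int_if_no_common_prime)
    fix p :: int
    assume p: "prime p" "p dvd k" "p dvd W"
    have "W = 1 + S * (5 * a + 25 * a ^ 3)"
      unfolding a W_def by (simp add: eval_nat_numeral algebra_simps)
    moreover have "p dvd S * (5 * a + 25 * a ^ 3)" using p(2) k by simp
    ultimately have "p dvd 1" using p(3) by (metis dvd_add_left_iff)
    then show False using p(1) not_prime_unit by blast
  qed (use \<open>k > 0\<close> in simp)
  moreover have "k * W = \<bar>x\<bar> ^ 2" "\<bar>x\<bar> > 0" using kW \<open>k > 0\<close> \<open>W > 0\<close> by auto
  ultimately obtain N where "W = N\<^sup>2"
    using coprime_factors_of_nth_power_int[of k W "\<bar>x\<bar>" 2] \<open>k > 0\<close> \<open>W > 0\<close> by auto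
  then show False
    using quartic_no_solution[OF \<open>a > 0\<close>, of 1 N] by (simp add: W_def)
qed

end
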